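(* For any quantum states $\rho,\sigma$ on a finite-dimensional Hilbert space, with $\sigma$ invertible, the quantum chi-squared divergence $\chi^2(\rho\|\sigma)=\operatorname{Tr}(\rho^2\sigma^{-1})-1$ satisfies $$\chi^2(\rho\|\sigma)\ge\begin{cases}\|\rho-\sigma\|_1^2, & \text{if }\|\rho-\sigma\|_1\in[0,1],\\[4pt] \dfrac{\|\rho-\sigma\|_1}{2-\|\rho-\sigma\|_1}, & \text{if }\|\rho-\sigma\|_1\in(1,2].\end{cases}$$
   Context: A quantum state is a positive semidefinite operator of trace $1$ on a finite-dimensional complex Hilbert space. The trace distance is $\|\rho-\sigma\|_1=\operatorname{Tr}|\rho-\sigma|$, with $|X|=\sqrt{X^\dagger X}$ (no factor $1/2$). One also has $\chi^2(\rho\|\sigma)=\operatorname{Tr}\bigl((\rho-\sigma)^2\sigma^{-1}\bigr)$. *)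

theory Defs
  imports
    "Jordan_Normal_Form.Schur_Decomposition"
    "Jordan_Normal_Form.Gauss_Jordan_Elimination"
    "HOL-Library.Extended_Real"
begin

text \<open>
  Operators on an \<open>n\<close>-dimensional complex Hilbert space are represented by complex
  \<open>n \<times> n\<close> matrices, with respect to an orthonormal basis.
\<close>

definition mat_trace :: "complex mat \<Rightarrow> complex" where
  "mat_trace A = (\<Sum>i<dim_row A. A $$ (i, i))"

text \<open>
  The order on \<^typ>\<open>complex\<close> is that of \<open>HOL-Library.Complex_Order\<close>: \<open>0 \<le> z\<close> means that
  \<open>z\<close> is real and nonnegative.
\<close>

definition pos_semidef :: "nat \<Rightarrow> complex mat \<Rightarrow> bool" where
  "pos_semidef n A \<longleftrightarrow>
     A \<in> carrier_mat n n \<and> mat_adjoint A = A \<and>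
     (\<forall>v \<in> carrier_vec n. 0 \<le> (A *\<^sub>v v) \<bullet>c v)"

definition quantum_state :: "nat \<Rightarrow> complex mat \<Rightarrow> bool" where
  "quantum_state n \<rho> \<longleftrightarrow> pos_semidef n \<rho> \<and> mat_trace \<rho> = 1"

text \<open>Meaningful for positive semidefinite \<open>A\<close>, which have exactly one such root.\<close>

definition psd_sqrt :: "complex mat \<Rightarrow> complex mat" where
  "psd_sqrt A = (THE S. pos_semidef (dim_row A) S \<and> S * S = A)"

definition mat_abs :: "complex mat \<Rightarrow> complex mat" where
  "mat_abs X = psd_sqrt (mat_adjoint X * X)"

text \<open>
  The traces in the next two definitions are real numbers (for states \<open>\<rho>\<close> and \<open>\<sigma>\<close>, with
  \<open>\<sigma>\<close> invertible), so \<^const>\<open>Re\<close> only changes the type. There is no factor \<open>1/2\<close> in the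
  trace distance.
\<close>

definition trace_dist :: "complex mat \<Rightarrow> complex mat \<Rightarrow> real" where
  "trace_dist \<rho> \<sigma> = Re (mat_trace (mat_abs (\<rho> - \<sigma>)))"

definition chi2_div :: "complex mat \<Rightarrow> complex mat \<Rightarrow> real" where
  "chi2_div \<rho> \<sigma> = Re (mat_trace (\<rho> * \<rho> * the (mat_inverse \<sigma>))) - 1"

end

theory Submission
  imports Defs "Jordan_Normal_Form.Spectral_Radius"
begin

text \<open>
  In an orthonormal eigenbasis of \<open>\<rho> - \<sigma>\<close>, with eigenvalues \<open>d\<^sub>i\<close>, the diagonals \<open>p\<close> of \<open>\<rho>\<close> and
  \<open>q\<close> of \<open>\<sigma>\<close> are probability vectors with \<open>p\<^sub>i - q\<^sub>i = d\<^sub>i\<close>, so the trace distance is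
  \<open>\<Sum>\<^sub>i \<bar>p\<^sub>i - q\<^sub>i\<bar>\<close>. Since \<open>(\<sigma>\<^sup>-\<^sup>1)\<^sub>i\<^sub>i \<ge> 1 / q\<^sub>i\<close>, the quantum divergence
  \<open>\<Sum>\<^sub>i d\<^sub>i\<^sup>2 (\<sigma>\<^sup>-\<^sup>1)\<^sub>i\<^sub>i\<close> dominates the classical divergence of \<open>p\<close> and \<open>q\<close>. If \<open>t\<close> is the
  trace distance and \<open>b\<close> the \<open>q\<close>-mass of the indices with \<open>d\<^sub>i < 0\<close>, Cauchy-Schwarz on the two sign
  classes bounds the latter from below by \<open>(t/2)\<^sup>2 / (b (1 - b))\<close>. This is at least \<open>t\<^sup>2\<close>, and
  \<open>b \<ge> t/2\<close> improves it to \<open>t / (2 - t)\<close> when \<open>t > 1\<close>.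
\<close>

subsection \<open>The classical divergence\<close>

text \<open>Cauchy-Schwarz in its weighted form: the sum of
  \<open>(x i - m * q i)\<^sup>2 / q i\<close> is nonnegative for every \<open>m\<close>, and the
  value of \<open>m\<close> chosen here minimizes it.\<close>

lemma sum_square_le:
  fixes x q :: "'a \<Rightarrow> real"
  assumes "\<And>i. i \<in> I \<Longrightarrow> q i > 0"
  shows "(\<Sum>i\<in>I. x i)\<^sup>2 \<le> (\<Sum>i\<in>I. (x i)\<^sup>2 / q i) * (\<Sum>i\<in>I. q i)"
proof (cases "finite I \<and> I \<noteq> {}")
  case True
  define m where "m = sum x I / sum q I"
  have Q: "sum q I > 0"
    using True assms by (intro sum_pos) auto
  have "0 \<le> (\<Sum>i\<in>I. (x i - m * q i)\<^sup>2 / q i)"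
    using assms by (intro sum_nonneg divide_nonneg_pos) auto
  also have "\<dots> = (\<Sum>i\<in>I. (x i)\<^sup>2 / q i - 2 * m * x i + m\<^sup>2 * q i)"
  proof (rule sum.cong)
    fix i assume "i \<in> I"
    then show "(x i - m * q i)\<^sup>2 / q i = (x i)\<^sup>2 / q i - 2 * m * x i + m\<^sup>2 * q i"
      using assms[of i] by (simp add: field_simps power2_eq_square)
  qed simp
  also have "\<dots> = (\<Sum>i\<in>I. (x i)\<^sup>2 / q i) - 2 * m * sum x I + m\<^sup>2 * sum q I"
    by (simp add: sum.distrib sum_subtractf sum_distrib_left)
  also have "\<dots> = (\<Sum>i\<in>I. (x i)\<^sup>2 / q i) - (sum x I)\<^sup>2 / sum q I"
    using Q by (simp add: m_def field_simps power2_eq_square)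
  finally show ?thesis
    using Q by (simp add: divide_le_eq)
qed auto

text \<open>The bound \<open>C\<close> is left abstract so that the quantum divergence can be put in
  its place. The conclusion \<open>t < 2\<close> guards the quotient, as real division by zero would
  give 0.\<close>

lemma classical_chi2_bound:
  fixes p q :: "'a \<Rightarrow> real"
  assumes fin: "finite I"
    and p: "\<And>i. i \<in> I \<Longrightarrow> p i \<ge> 0" "sum p I = 1"
    and q: "\<And>i. i \<in> I \<Longrightarrow> q i > 0" "sum q I = 1"
    and t: "t = (\<Sum>i\<in>I. \<bar>p i - q i\<bar>)"
    and C: "(\<Sum>i\<in>I. (p i - q i)\<^sup>2 / q i) \<le> C"
  shows "t\<^sup>2 \<le> C" and "1 < t \<Longrightarrow> t < 2 \<and> t / (2 - t) \<le> C"
proof -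
  define P N where "P = {i \<in> I. p i \<ge> q i}" and "N = {i \<in> I. p i < q i}"
  have split: "sum f I = sum f P + sum f N" for f :: "'a \<Rightarrow> real"
  proof -
    have "I = P \<union> N" "P \<inter> N = {}" "finite P" "finite N"
      using fin by (auto simp: P_def N_def)
    then show ?thesis
      by (simp add: sum.union_disjoint)
  qed
  have abs: "(\<Sum>i\<in>P. \<bar>p i - q i\<bar>) = (\<Sum>i\<in>P. p i - q i)" "(\<Sum>i\<in>N. \<bar>p i - q i\<bar>) = - (\<Sum>i\<in>N. p i - q i)"
    by (auto simp: P_def N_def sum_negf[symmetric] simp del: sum_subtractf intro!: sum.cong)
  have "(\<Sum>i\<in>P. p i - q i) + (\<Sum>i\<in>N. p i - q i) = 0"
    using split[of "\<lambda>i. p i - q i"] p(2) q(2) by (simp add: sum_subtractf)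
  \<comment> \<open>Both vectors have total mass 1, so the positive and negative parts of
    \<open>p - q\<close> cancel and each carries half of the absolute sum.\<close>
  then have half: "(\<Sum>i\<in>P. p i - q i) = t / 2" "(\<Sum>i\<in>N. p i - q i) = - t / 2"
    unfolding t split abs by auto
  define b where "b = sum q N"
  have a: "sum q P = 1 - b"
    using split[of q] q(2) by (simp add: b_def)
  have "0 \<le> sum p N"
    using p(1) by (intro sum_nonneg) (auto simp: N_def)
  \<comment> \<open>The p-mass of \<open>N\<close> equals \<open>b - t / 2\<close>.\<close>
  then have bt: "t / 2 \<le> b"
    using half(2) by (simp add: sum_subtractf b_def)
  have t0: "0 \<le> t"
    by (simp add: t sum_nonneg)
  have b1: "0 < b \<and> b < 1" if "t \<noteq> 0"
  proof -
    have "P \<noteq> {}"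
      using half(1) that by auto
    then have "0 < sum q P"
      using fin q(1) by (intro sum_pos) (auto simp: P_def)
    then show ?thesis
      using a bt t0 that by auto
  qed
  define X Y where "X = (\<Sum>i\<in>P. (p i - q i)\<^sup>2 / q i)" and "Y = (\<Sum>i\<in>N. (p i - q i)\<^sup>2 / q i)"
  have XY: "X + Y \<le> C"
    using C unfolding split X_def Y_def .
  have X: "(t / 2)\<^sup>2 \<le> X * (1 - b)"
    using sum_square_le[of P q "\<lambda>i. p i - q i"] q(1) by (auto simp: P_def[symmetric] half a X_def) (auto simp: P_def)
  have Y: "(t / 2)\<^sup>2 \<le> Y * b"
    using sum_square_le[of N q "\<lambda>i. p i - q i"] q(1) by (auto simp: half b_def Y_def) (auto simp: N_def)
  have main: "(t / 2)\<^sup>2 / (b * (1 - b)) \<le> C" if "t \<noteq> 0"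
  proof -
    \<comment> \<open>The two Cauchy-Schwarz bounds add up because 1/b + 1/(1 - b) = 1/(b (1 -
      b)).\<close>
    have "(t / 2)\<^sup>2 / (b * (1 - b)) = (t / 2)\<^sup>2 / (1 - b) + (t / 2)\<^sup>2 / b"
      using b1[OF that] by (simp add: field_simps)
    also have "\<dots> \<le> X + Y"
      using X Y b1[OF that] by (intro add_mono) (auto simp: divide_le_eq)
    finally show ?thesis
      using XY by simp
  qed
  show "t\<^sup>2 \<le> C"
  proof (cases "t = 0")
    case True
    have "0 \<le> X" "0 \<le> Y"
      using q(1) by (auto simp: X_def Y_def P_def N_def intro!: sum_nonneg divide_nonneg_pos)
    then show ?thesis
      using XY True by simp
  next
    case False
    \<comment> \<open>The constant 1/4 is the maximum of b (1 - b), attained at b = 1/2.\<close>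
    have "t\<^sup>2 = (t / 2)\<^sup>2 / (1 / 4)"
      by (simp add: power2_eq_square)
    also have "\<dots> \<le> (t / 2)\<^sup>2 / (b * (1 - b))"
      using b1[OF False] zero_le_power2[of "b - 1 / 2"]
      by (intro divide_left_mono) (auto simp: power2_eq_square algebra_simps)
    finally show ?thesis
      using main[OF False] by simp
  qed
  show "t < 2 \<and> t / (2 - t) \<le> C" if t1: "1 < t"
  proof
    show t2: "t < 2"
      using b1 bt t1 by auto
    \<comment> \<open>As b >= t/2 > 1/2 > 1 - t/2, both factors are nonnegative. This expresses that
      b (1 - b) decreases beyond 1/2, so replacing \<open>b\<close> by \<open>t / 2\<close> only
      enlarges it.\<close>
    have "0 \<le> (b - t / 2) * (b - (1 - t / 2))"
      using bt t1 by (intro mult_nonneg_nonneg) auto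
    then have "b * (1 - b) \<le> t / 2 * (1 - t / 2)"
      by (simp add: algebra_simps)
    then have "(t / 2)\<^sup>2 / (t / 2 * (1 - t / 2)) \<le> (t / 2)\<^sup>2 / (b * (1 - b))"
      using b1 t1 t2 by (intro divide_left_mono) auto
    also have "(t / 2)\<^sup>2 / (t / 2 * (1 - t / 2)) = t / (2 - t)"
      using t1 t2 by (simp add: field_simps power2_eq_square)
    finally show "t / (2 - t) \<le> C"
      using main t1 by auto
  qed
qed

subsection \<open>Adjoints\<close>

lemma index_mat_adjoint [simp]:
  "i < dim_col A \<Longrightarrow> j < dim_row A \<Longrightarrow> mat_adjoint A $$ (i, j) = conjugate (A $$ (j, i))"
  by (simp add: mat_adjoint_def mat_of_rows_index)

lemma dim_mat_adjoint [simp]: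
  "dim_row (mat_adjoint A) = dim_col A" "dim_col (mat_adjoint A) = dim_row A"
  by (simp_all add: mat_adjoint_def)

lemma mat_adjoint_carrier [simp]: "A \<in> carrier_mat m n \<Longrightarrow> mat_adjoint A \<in> carrier_mat n m"
  by auto

lemma mult_carrier_square [simp]:
  "A \<in> carrier_mat n n \<Longrightarrow> B \<in> carrier_mat n n \<Longrightarrow> A * B \<in> carrier_mat n n"
  "A \<in> carrier_mat n n \<Longrightarrow> v \<in> carrier_vec n \<Longrightarrow> A *\<^sub>v v \<in> carrier_vec n"
  by auto

lemma mat_adjoint_adjoint [simp]: "mat_adjoint (mat_adjoint A) = A"
  by (rule eq_matI) auto

lemma mat_adjoint_mult:
  fixes A B :: "complex mat"
  assumes "A \<in> carrier_mat m n" "B \<in> carrier_mat n k"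
  shows "mat_adjoint (A * B) = mat_adjoint B * mat_adjoint A"
  using assms
  by (intro eq_matI) (auto simp: scalar_prod_def mult.commute intro!: sum.cong)

lemma mat_adjoint_minus:
  fixes A B :: "complex mat"
  assumes "A \<in> carrier_mat m n" "B \<in> carrier_mat m n"
  shows "mat_adjoint (A - B) = mat_adjoint A - mat_adjoint B"
  using assms by (intro eq_matI) auto

lemma cscalar_prod_mult_mat_vec:
  fixes A :: "complex mat"
  assumes "A \<in> carrier_mat m n" "v \<in> carrier_vec n" "w \<in> carrier_vec m"
  shows "(A *\<^sub>v v) \<bullet>c w = v \<bullet>c (mat_adjoint A *\<^sub>v w)"
proof -
  have "(A *\<^sub>v v) \<bullet>c w = (\<Sum>i<m. \<Sum>j<n. A $$ (i,j) * v $ j * cnj (w $ i))"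
    using assms by (simp add: scalar_prod_def atLeast0LessThan sum_distrib_right)
  also have "\<dots> = (\<Sum>j<n. \<Sum>i<m. A $$ (i,j) * v $ j * cnj (w $ i))"
    by (rule sum.swap)
  also have "\<dots> = v \<bullet>c (mat_adjoint A *\<^sub>v w)"
    using assms by (simp add: scalar_prod_def atLeast0LessThan sum_distrib_left mult_ac)
  finally show ?thesis .
qed

lemma mult_mat_unit_vec:
  fixes A :: "complex mat"
  assumes "A \<in> carrier_mat m n" "i < n"
  shows "A *\<^sub>v unit_vec n i = col A i"
  using assms by (intro eq_vecI) auto

lemma conjugate_unit_vec [simp]: "conjugate (unit_vec n i :: complex vec) = unit_vec n i"
  by (rule eq_vecI) (auto simp: unit_vec_def)

subsection \<open>Diagonalization of Hermitian matrices\<close>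

text \<open>Gram-Schmidt leaves the first vector of a basis unchanged. Started at \<open>v\<close>
  it gives orthogonal vectors \<open>ws\<close>, and dividing each by its norm \<open>N\<close>
  makes them the columns of a unitary matrix.\<close>

lemma unitary_with_first_column:
  fixes v :: "complex vec"
  assumes v: "v \<in> carrier_vec n" and v0: "v \<noteq> 0\<^sub>v n"
  obtains W c where "W \<in> carrier_mat n n" "mat_adjoint W * W = 1\<^sub>m n" "col W 0 = c \<cdot>\<^sub>v v"
proof -
  interpret cof_vec_space n "TYPE(complex)" .
  define ws where "ws = gram_schmidt n (basis_completion v)"
  define N where "N = (\<lambda>j. sqrt (Re (ws ! j \<bullet>c ws ! j)))"
  define W where "W = mat n n (\<lambda>(i, j). ws ! j $ i / complex_of_real (N j))"
  note b = basis_completion[OF v v0]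
  have n0: "n > 0"
    using v v0 by (cases n) auto
  obtain bs where bs: "basis_completion v = v # bs"
    using b(6,7) n0 by (cases "basis_completion v") auto
  note g = gram_schmidt_result[OF b(2,4,5) refl, folded ws_def]
  have len: "length ws = n"
    using g(4) b(6) by simp
  have "hd ws = v"
    using gram_schmidt_hd[OF v, of bs] by (simp add: ws_def bs)
  then have hd: "ws ! 0 = v"
    using len n0 by (cases ws) auto
  have ws: "ws ! j \<in> carrier_vec n" if "j < n" for j
    using g(3) len that by auto
  have N: "ws ! j \<bullet>c ws ! j = complex_of_real (N j) * complex_of_real (N j) \<and> N j \<noteq> 0" if "j < n" for j
  proof -
    have "ws ! j \<bullet>c ws ! j \<ge> 0"
      by (rule conjugate_square_ge_0_vec)
    moreover have "ws ! j \<bullet>c ws ! j \<noteq> 0"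
      using corthogonalD[OF g(2)] that len by simp
    ultimately show ?thesis
      by (auto simp: N_def less_eq_complex_def complex_eq_iff simp flip: of_real_mult)
  qed
  have "mat_adjoint W * W = 1\<^sub>m n"
  proof (rule eq_matI)
    fix i j assume "i < dim_row (1\<^sub>m n :: complex mat)" "j < dim_col (1\<^sub>m n :: complex mat)"
    then have ij: "i < n" "j < n" by auto
    have "(mat_adjoint W * W) $$ (i,j) = (\<Sum>k<n. cnj (W $$ (k,i)) * W $$ (k,j))"
      using ij by (simp add: scalar_prod_def W_def atLeast0LessThan)
    also have "\<dots> = (\<Sum>k<n. ws ! j $ k * cnj (ws ! i $ k)) / (complex_of_real (N i) * complex_of_real (N j))"
      using ij by (simp add: W_def sum_divide_distrib mult_ac)
    also have "(\<Sum>k<n. ws ! j $ k * cnj (ws ! i $ k)) = ws ! j \<bullet>c ws ! i"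
      using ws[OF ij(1)] by (simp add: scalar_prod_def atLeast0LessThan)
    also have "\<dots> / (complex_of_real (N i) * complex_of_real (N j)) = (if i = j then 1 else 0)"
      using N[OF ij(2)] corthogonalD[OF g(2), of j i] ij len by auto
    finally show "(mat_adjoint W * W) $$ (i, j) = 1\<^sub>m n $$ (i, j)"
      using ij by simp
  qed (simp_all add: W_def)
  moreover have "col W 0 = (1 / complex_of_real (N 0)) \<cdot>\<^sub>v v"
    using n0 v by (intro eq_vecI) (auto simp: W_def hd)
  ultimately show ?thesis
    using that[of W] by (simp add: W_def)
qed

text \<open>Induction on the dimension: in an orthonormal basis that begins with an eigenvector, a
  Hermitian matrix is block diagonal, and the lower block is again Hermitian.\<close>

lemma hermitian_diagonalization:
  fixes A :: "complex mat"
  assumes "A \<in> carrier_mat n n" "mat_adjoint A = A"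
  obtains U and d :: "nat \<Rightarrow> real" where "U \<in> carrier_mat n n" "mat_adjoint U * U = 1\<^sub>m n"
    "A * U = U * mat_diag n (\<lambda>i. complex_of_real (d i))"
proof -
  have "\<exists>U (d :: nat \<Rightarrow> real). U \<in> carrier_mat n n \<and> mat_adjoint U * U = 1\<^sub>m n \<and>
      A * U = U * mat_diag n (\<lambda>i. complex_of_real (d i))"
    using assms
  proof (induction n arbitrary: A)
    case 0
    show ?case
      by (rule exI[of _ "1\<^sub>m 0"], rule exI[of _ "\<lambda>_. 0"]) (use 0 in \<open>auto simp: mat_diag_def\<close>)
  next
    case (Suc m)
    let ?n = "Suc m"
    note A = Suc.prems(1)
    obtain e v where "eigenvector A v e"
      using spectrum_non_empty[OF A] by (auto simp: spectrum_def eigenvalue_def)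
    then have v: "v \<in> carrier_vec ?n" "v \<noteq> 0\<^sub>v ?n" and ev: "A *\<^sub>v v = e \<cdot>\<^sub>v v"
      using A by (auto simp: eigenvector_def)
    obtain W c where W: "W \<in> carrier_mat ?n ?n" and WW: "mat_adjoint W * W = 1\<^sub>m ?n"
      and Wc: "col W 0 = c \<cdot>\<^sub>v v"
      using unitary_with_first_column[OF v] .
    have WW': "W * mat_adjoint W = 1\<^sub>m ?n"
      using mat_mult_left_right_inverse[OF _ W WW] W by auto
    define A' where "A' = mat_adjoint W * (A * W)"
    have A': "A' \<in> carrier_mat ?n ?n"
      using W A by (auto simp: A'_def)
    have herm: "mat_adjoint A' = A'"
      using W A Suc.prems(2)
      by (simp add: A'_def mat_adjoint_mult[of _ ?n ?n _ ?n] assoc_mult_mat[of _ ?n ?n _ ?n _ ?n])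
    have AW: "A * W = W * A'"
      unfolding A'_def using W A WW'
      by (simp add: assoc_mult_mat[of W ?n ?n "mat_adjoint W" ?n "A * W" ?n, symmetric])
    \<comment> \<open>The first basis vector is an eigenvector, so the first column of
      \<open>A'\<close> is \<open>e\<close> followed by zeros; hermiticity carries this over to the
      first row.\<close>
    have "col A' 0 = mat_adjoint W *\<^sub>v col (A * W) 0"
      unfolding A'_def using W A by (intro col_mult2[of _ ?n ?n _ ?n]) auto
    also have "col (A * W) 0 = A *\<^sub>v col W 0"
      using W A by (intro col_mult2[of _ ?n ?n _ ?n]) auto
    also have "A *\<^sub>v col W 0 = e \<cdot>\<^sub>v col W 0"
      unfolding Wc using A v ev by (simp add: mult_mat_vec smult_smult_assoc mult.commute)
    also have "mat_adjoint W *\<^sub>v (e \<cdot>\<^sub>v col W 0) = e \<cdot>\<^sub>v (mat_adjoint W *\<^sub>v col W 0)"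
      using W by (intro mult_mat_vec[of _ ?n ?n]) (auto intro!: carrier_vecI)
    also have "mat_adjoint W *\<^sub>v col W 0 = col (1\<^sub>m ?n) 0"
      using W by (simp add: WW[symmetric] col_mult2[of _ ?n ?n _ ?n])
    finally have col0: "col A' 0 = e \<cdot>\<^sub>v unit_vec ?n 0"
      by simp
    have c0: "A' $$ (i, 0) = (if i = 0 then e else 0)" if "i < ?n" for i
      using arg_cong[OF col0, of "\<lambda>x. x $ i"] A' that by auto
    have cnjA': "A' $$ (i, j) = cnj (A' $$ (j, i))" if "i < ?n" "j < ?n" for i j
      using index_mat_adjoint[of i A' j] herm A' that by simp
    have r0: "A' $$ (0, j) = (if j = 0 then e else 0)" if "j < ?n" for j
      using cnjA'[of 0 j] c0[of j] c0[of 0] that by auto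
    \<comment> \<open>The eigenvalue is a diagonal entry of a Hermitian matrix, hence real.\<close>
    have e: "e = complex_of_real (Re e)"
      using cnjA'[of 0 0] c0[of 0] by (simp add: complex_eq_iff)
    define B where "B = mat m m (\<lambda>(i, j). A' $$ (Suc i, Suc j))"
    have B: "B \<in> carrier_mat m m"
      by (simp add: B_def)
    have "mat_adjoint B = B"
      by (rule eq_matI) (auto simp: B_def intro: cnjA'[symmetric])
    then obtain V d where V: "V \<in> carrier_mat m m" and VV: "mat_adjoint V * V = 1\<^sub>m m"
      and BV: "B * V = V * mat_diag m (\<lambda>i. complex_of_real (d i))"
      using Suc.IH[OF B] by blast
    \<comment> \<open>\<open>V'\<close> is the block diagonal matrix with blocks 1 and
      \<open>V\<close>; \<open>W * V'\<close> will diagonalize \<open>A\<close>.\<close>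
    define V' where "V' = mat ?n ?n (\<lambda>(i, j). case (i, j) of (0, 0) \<Rightarrow> 1 | (Suc i, Suc j) \<Rightarrow> V $$ (i, j) | _ \<Rightarrow> 0)"
    define d' where "d' = (\<lambda>i. case i of 0 \<Rightarrow> Re e | Suc i \<Rightarrow> d i)"
    have V': "V' \<in> carrier_mat ?n ?n"
      by (simp add: V'_def)
    have V'V': "mat_adjoint V' * V' = 1\<^sub>m ?n"
    proof (rule eq_matI)
      fix i j assume "i < dim_row (1\<^sub>m ?n :: complex mat)" "j < dim_col (1\<^sub>m ?n :: complex mat)"
      then have ij: "i < ?n" "j < ?n" by auto
      have "(mat_adjoint V' * V') $$ (i, j) = (\<Sum>k<?n. cnj (V' $$ (k, i)) * V' $$ (k, j))"
        using ij V' by (simp add: scalar_prod_def atLeast0LessThan del: sum.lessThan_Suc)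
      moreover have "(\<Sum>k<m. cnj (V $$ (k, i)) * V $$ (k, j)) = (if i = j then 1 else 0)" if "i < m" "j < m" for i j
        using arg_cong[OF VV, of "\<lambda>M. M $$ (i,j)"] that V by (simp add: scalar_prod_def atLeast0LessThan)
      ultimately show "(mat_adjoint V' * V') $$ (i, j) = 1\<^sub>m ?n $$ (i, j)"
        using ij by (auto simp: V'_def sum.lessThan_Suc_shift split: nat.split simp del: sum.lessThan_Suc)
    qed (use V' in auto)
    have A'V': "A' * V' = V' * mat_diag ?n (\<lambda>i. complex_of_real (d' i))"
    proof (rule eq_matI)
      fix i j assume "i < dim_row (V' * mat_diag ?n (\<lambda>i. complex_of_real (d' i)))"
        "j < dim_col (V' * mat_diag ?n (\<lambda>i. complex_of_real (d' i)))"
      then have ij: "i < ?n" "j < ?n" using V' by (auto simp: mat_diag_def)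
      have "(A' * V') $$ (i, j) = (\<Sum>k<?n. A' $$ (i, k) * V' $$ (k, j))"
        using ij V' A' by (simp add: scalar_prod_def atLeast0LessThan del: sum.lessThan_Suc)
      moreover have "(\<Sum>k<m. A' $$ (Suc i, Suc k) * V $$ (k, j)) = V $$ (i, j) * d j" if "i < m" "j < m" for i j
        using arg_cong[OF BV, of "\<lambda>M. M $$ (i,j)"] that V
        by (simp add: scalar_prod_def atLeast0LessThan B_def mat_diag_mult_right[OF V])
      moreover have "(V' * mat_diag ?n (\<lambda>i. complex_of_real (d' i))) $$ (i, j) = V' $$ (i, j) * d' j"
        using ij by (simp add: mat_diag_mult_right[OF V'])
      ultimately show "(A' * V') $$ (i, j) = (V' * mat_diag ?n (\<lambda>i. complex_of_real (d' i))) $$ (i, j)"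
        using ij c0 r0 e
        by (cases i; cases j) (simp_all add: V'_def d'_def sum.lessThan_Suc_shift del: sum.lessThan_Suc)
    qed (use V' A' in \<open>auto simp: mat_diag_def\<close>)
    have "mat_adjoint (W * V') * (W * V') = mat_adjoint V' * (mat_adjoint W * W) * V'"
      using W V' by (simp add: mat_adjoint_mult[of _ ?n ?n _ ?n] assoc_mult_mat[of _ ?n ?n _ ?n _ ?n])
    also have "\<dots> = 1\<^sub>m ?n"
      using V' V'V' by (simp add: WW)
    finally have "mat_adjoint (W * V') * (W * V') = 1\<^sub>m ?n" .
    moreover have "A * (W * V') = (W * V') * mat_diag ?n (\<lambda>i. complex_of_real (d' i))"
      using W V' A A' by (simp add: AW A'V' assoc_mult_mat[of _ ?n ?n _ ?n _ ?n]
          flip: assoc_mult_mat[of A ?n ?n W ?n V' ?n])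
    ultimately show ?case
      using W V' by (meson mult_carrier_mat)
  qed
  then show ?thesis
    using that by blast
qed

subsection \<open>Traces and positive semidefinite matrices\<close>

lemma mat_trace_comm:
  assumes "A \<in> carrier_mat n m" "B \<in> carrier_mat m n"
  shows "mat_trace (A * B) = mat_trace (B * A)"
proof -
  have "mat_trace (A * B) = (\<Sum>i<n. \<Sum>j<m. A $$ (i, j) * B $$ (j, i))"
    using assms by (simp add: mat_trace_def scalar_prod_def atLeast0LessThan)
  also have "\<dots> = (\<Sum>j<m. \<Sum>i<n. B $$ (j, i) * A $$ (i, j))"
    by (subst sum.swap) (simp add: mult.commute)
  also have "\<dots> = mat_trace (B * A)"
    using assms by (simp add: mat_trace_def scalar_prod_def atLeast0LessThan)
  finally show ?thesis .
qed

lemma mat_trace_minus: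
  assumes "A \<in> carrier_mat n n" "B \<in> carrier_mat n n"
  shows "mat_trace (A - B) = mat_trace A - mat_trace B"
  using assms by (simp add: mat_trace_def sum_subtractf)

lemma mat_trace_unitary_conj:
  assumes "A \<in> carrier_mat n n" "U \<in> carrier_mat n n" "U * mat_adjoint U = 1\<^sub>m n"
  shows "mat_trace (mat_adjoint U * A * U) = mat_trace A"
proof -
  have "mat_trace (mat_adjoint U * A * U) = mat_trace (U * (mat_adjoint U * A))"
    using assms by (intro mat_trace_comm) auto
  also have "U * (mat_adjoint U * A) = U * mat_adjoint U * A"
    using assms by (intro assoc_mult_mat[symmetric]) auto
  finally show ?thesis
    using assms by simp
qed

lemma pos_semidef_conj:
  assumes "pos_semidef n A" "U \<in> carrier_mat n n"
  shows "pos_semidef n (mat_adjoint U * A * U)"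
  unfolding pos_semidef_def
proof (intro conjI ballI)
  have A: "A \<in> carrier_mat n n" "mat_adjoint A = A"
    using assms(1) by (auto simp: pos_semidef_def)
  note U = assms(2)
  show "mat_adjoint U * A * U \<in> carrier_mat n n"
    using A U by auto
  show "mat_adjoint (mat_adjoint U * A * U) = mat_adjoint U * A * U"
    using A U by (simp add: mat_adjoint_mult[of _ n n _ n] assoc_mult_mat[of _ n n _ n _ n])
  fix v :: "complex vec" assume v: "v \<in> carrier_vec n"
  have "(mat_adjoint U * A * U *\<^sub>v v) \<bullet>c v = (mat_adjoint U *\<^sub>v (A *\<^sub>v (U *\<^sub>v v))) \<bullet>c v"
    using A U v by (simp add: assoc_mult_mat[of _ n n _ n _ n] assoc_mult_mat_vec[of _ n n _ n])
  also have "\<dots> = (A *\<^sub>v (U *\<^sub>v v)) \<bullet>c (U *\<^sub>v v)"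
    using A U v by (simp add: cscalar_prod_mult_mat_vec[of _ n n])
  also have "0 \<le> \<dots>"
    using assms(1) mult_mat_vec_carrier[OF U v] unfolding pos_semidef_def by blast
  finally show "0 \<le> (mat_adjoint U * A * U *\<^sub>v v) \<bullet>c v" .
qed

lemma pos_semidef_mat_diag:
  assumes "\<And>i. i < n \<Longrightarrow> 0 \<le> d i"
  shows "pos_semidef n (mat_diag n (\<lambda>i. complex_of_real (d i)))"
  unfolding pos_semidef_def
proof (intro conjI ballI)
  let ?D = "mat_diag n (\<lambda>i. complex_of_real (d i))"
  show "?D \<in> carrier_mat n n" by simp
  show "mat_adjoint ?D = ?D"
    by (rule eq_matI) (auto simp: mat_diag_def)
  fix v :: "complex vec" assume v: "v \<in> carrier_vec n"
  have "(?D *\<^sub>v v) $ i = d i * v $ i" if "i < n" for i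
  proof -
    have "(?D *\<^sub>v v) $ i = (\<Sum>j<n. if i = j then d j * v $ j else 0)"
      using v that by (simp add: mat_diag_def scalar_prod_def atLeast0LessThan if_distrib[of "\<lambda>x. x * _"] cong: if_cong)
    also have "\<dots> = d i * v $ i"
      using that by simp
    finally show ?thesis .
  qed
  then have "(?D *\<^sub>v v) \<bullet>c v = (\<Sum>i<n. complex_of_real (d i) * (v $ i * cnj (v $ i)))"
    using v by (simp add: scalar_prod_def atLeast0LessThan mat_diag_def mult.assoc)
  also have "\<dots> = complex_of_real (\<Sum>i<n. d i * (cmod (v $ i))\<^sup>2)"
    by (simp add: complex_norm_square del: of_real_power)
  also have "0 \<le> \<dots>"
    using assms by (auto simp: less_eq_complex_def intro!: sum_nonneg)
  finally show "0 \<le> (?D *\<^sub>v v) \<bullet>c v" .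
qed

lemma pos_semidef_diag_nonneg:
  assumes "pos_semidef n A" "i < n"
  shows "0 \<le> A $$ (i, i)"
proof -
  have "(A *\<^sub>v unit_vec n i) \<bullet>c unit_vec n i = A $$ (i, i)"
    using assms by (auto simp: pos_semidef_def mult_mat_unit_vec[of _ n n])
  then show ?thesis
    using assms by (metis pos_semidef_def unit_vec_carrier)
qed

text \<open>Since \<open>psd_sqrt\<close> is a definite description, the candidate must be shown to
  be a positive semidefinite root of \<open>X * X\<close> and the only one. Uniqueness holds because
  any such root acts on each column of \<open>U\<close> as multiplication by
  \<open>\<bar>d i\<bar>\<close>.\<close>

lemma mat_abs_hermitian:
  assumes X: "X \<in> carrier_mat n n" "mat_adjoint X = X"
    and U: "U \<in> carrier_mat n n" "mat_adjoint U * U = 1\<^sub>m n"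
    and XU: "X * U = U * mat_diag n (\<lambda>i. complex_of_real (d i))"
  shows "mat_abs X = U * mat_diag n (\<lambda>i. complex_of_real \<bar>d i\<bar>) * mat_adjoint U"
proof -
  let ?D = "mat_diag n (\<lambda>i. complex_of_real \<bar>d i\<bar>)"
  let ?E = "mat_diag n (\<lambda>i. complex_of_real (d i))"
  let ?S = "U * ?D * mat_adjoint U"
  have UU: "U * mat_adjoint U = 1\<^sub>m n"
    using mat_mult_left_right_inverse[OF _ U(1,2)] U by auto
  note assoc = assoc_mult_mat[of _ n n _ n _ n]
  have XXU: "X * X * U = U * mat_diag n (\<lambda>i. complex_of_real ((d i)\<^sup>2))"
  proof -
    have "X * X * U = X * (X * U)"
      using X U by (simp add: assoc)
    also have "\<dots> = X * (U * ?E)"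
      by (simp only: XU)
    also have "\<dots> = X * U * ?E"
      using X U by (simp add: assoc)
    also have "\<dots> = U * (?E * ?E)"
      unfolding XU using U by (simp add: assoc del: mat_diag_diag)
    finally show ?thesis
      by (simp add: power2_eq_square)
  qed
  have psd: "pos_semidef n ?S"
    using pos_semidef_conj[OF pos_semidef_mat_diag, of n "\<lambda>i. \<bar>d i\<bar>" "mat_adjoint U"] U(1)
    by simp
  have "?S * ?S = U * (?D * (mat_adjoint U * U * ?D)) * mat_adjoint U"
    using U(1) by (simp add: assoc del: mat_diag_diag)
  also have "\<dots> = X * X * U * mat_adjoint U"
    unfolding XXU by (simp add: U left_mult_one_mat[of _ n n] power2_eq_square flip: of_real_mult)
  also have "\<dots> = X * X"
    using X U UU by (simp add: assoc)
  finally have sq: "?S * ?S = X * X" .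
  have unique: "S = ?S" if S: "pos_semidef n S" "S * S = X * X" for S
  proof -
    have Sc: "S \<in> carrier_mat n n" "mat_adjoint S = S"
      using S by (auto simp: pos_semidef_def)
    have "S * U = U * ?D"
    proof (rule eq_matI)
      fix k i assume "k < dim_row (U * ?D)" "i < dim_col (U * ?D)"
      then have ki: "k < n" "i < n" using U by (auto simp: mat_diag_def)
      define u where "u = col U i"
      define \<mu> where "\<mu> = complex_of_real \<bar>d i\<bar>"
      \<comment> \<open>\<open>w\<close> measures how far \<open>u\<close> is from being an
        eigenvector of \<open>S\<close> for \<open>\<mu>\<close>; it has to vanish.\<close>
      define w where "w = S *\<^sub>v u - \<mu> \<cdot>\<^sub>v u"
      have u: "u \<in> carrier_vec n"
        using U ki by (simp add: u_def)
      have Su: "S *\<^sub>v u \<in> carrier_vec n"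
        using Sc u by auto
      have w: "w \<in> carrier_vec n"
        using Su u by (simp add: w_def)
      have "col (S * S * U) i = S * S *\<^sub>v u"
        unfolding u_def using Sc U ki by (intro col_mult2[of _ n n _ n]) auto
      then have "S *\<^sub>v (S *\<^sub>v u) = col (X * X * U) i"
        using assoc_mult_mat_vec[OF Sc(1) Sc(1) u] by (simp add: S(2))
      also have "\<dots> = (\<mu> * \<mu>) \<cdot>\<^sub>v u"
        using U ki by (intro eq_vecI) (auto simp: XXU mat_diag_mult_right[OF U(1)] u_def \<mu>_def power2_eq_square simp flip: of_real_mult)
      finally have SSu: "S *\<^sub>v (S *\<^sub>v u) = (\<mu> * \<mu>) \<cdot>\<^sub>v u" .
      have w0: "w = 0\<^sub>v n"
      proof (cases "d i = 0")
        case True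
        then have "S *\<^sub>v (S *\<^sub>v u) = 0\<^sub>v n"
          using SSu u by (auto simp: \<mu>_def)
        \<comment> \<open>Hermiticity turns the squared norm of Su into the inner product of u with
          S(Su), which is zero.\<close>
        then have "(S *\<^sub>v u) \<bullet>c (S *\<^sub>v u) = 0"
          using cscalar_prod_mult_mat_vec[of S n n u "S *\<^sub>v u"] Sc u Su by simp
        then have "S *\<^sub>v u = 0\<^sub>v n"
          using Su by simp
        then show ?thesis
          using True u by (intro eq_vecI) (auto simp: w_def \<mu>_def)
      next
        case False
        have "S *\<^sub>v w = S *\<^sub>v (S *\<^sub>v u) - \<mu> \<cdot>\<^sub>v (S *\<^sub>v u)"
          using Sc u Su by (simp add: w_def mult_minus_distrib_mat_vec[of _ n n] mult_mat_vec[of _ n n])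
        also have "\<dots> = (- \<mu>) \<cdot>\<^sub>v w"
          using Sc u by (intro eq_vecI) (auto simp: SSu w_def right_diff_distrib)
        finally have "(S *\<^sub>v w) \<bullet>c w = - \<mu> * (w \<bullet>c w)"
          using w by simp
        moreover have "0 \<le> (S *\<^sub>v w) \<bullet>c w"
          using S(1) w by (simp add: pos_semidef_def)
        moreover have "0 \<le> w \<bullet>c w"
          by (rule conjugate_square_ge_0_vec)
        ultimately have "w \<bullet>c w = 0"
          using False by (auto simp: less_eq_complex_def \<mu>_def complex_eq_iff mult_le_0_iff)
        then show ?thesis
          using w by simp
      qed
      have "(S *\<^sub>v u) $ k - \<mu> * u $ k = w $ k"
        using ki u Sc by (simp add: w_def)
      also have "\<dots> = 0"
        using ki by (simp add: w0)
      finally have "(S *\<^sub>v u) $ k = \<mu> * u $ k"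
        by simp
      then show "(S * U) $$ (k, i) = (U * ?D) $$ (k, i)"
        using ki Sc U by (simp add: mat_diag_mult_right[OF U(1)] u_def \<mu>_def)
    qed (use Sc U in \<open>auto simp: mat_diag_def\<close>)
    then have "S * U * mat_adjoint U = ?S"
      by simp
    then show ?thesis
      using Sc U UU by (simp add: assoc)
  qed
  have "psd_sqrt (X * X) = ?S"
    unfolding psd_sqrt_def
  proof (rule the_equality)
    show "pos_semidef (dim_row (X * X)) ?S \<and> ?S * ?S = X * X"
      using X(1) psd sq by simp
    show "S = ?S" if "pos_semidef (dim_row (X * X)) S \<and> S * S = X * X" for S
      using that X(1) by (intro unique) auto
  qed
  then show ?thesis
    by (simp add: mat_abs_def X)
qed

text \<open>Positivity of \<open>S\<close> on the vector \<open>S\<^sup>-\<^sup>1 e\<^sub>i - t e\<^sub>i\<close> makes the quadratic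
  \<open>T\<^sub>i\<^sub>i - 2 t + t\<^sup>2 S\<^sub>i\<^sub>i\<close> nonnegative for all real \<open>t\<close>.\<close>
lemma pos_semidef_inverse_diag:
  assumes S: "pos_semidef n S" and T: "T \<in> carrier_mat n n" "S * T = 1\<^sub>m n" and i: "i < n"
  shows "0 < Re (S $$ (i, i))" "1 / Re (S $$ (i, i)) \<le> Re (T $$ (i, i))"
proof -
  define s where "s = Re (S $$ (i, i))"
  define r where "r = Re (T $$ (i, i))"
  have Sc: "S \<in> carrier_mat n n" "mat_adjoint S = S"
    using S by (auto simp: pos_semidef_def)
  have quad: "0 \<le> r - 2 * t + t\<^sup>2 * s" for t :: real
  proof -
    define e where "e = (unit_vec n i :: complex vec)"
    define v where "v = col T i - complex_of_real t \<cdot>\<^sub>v e"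
    have e: "e \<in> carrier_vec n" by (simp add: e_def)
    have Ti: "col T i \<in> carrier_vec n" using T i by simp
    have v: "v \<in> carrier_vec n"
      using e Ti by (simp add: v_def)
    have ST: "S *\<^sub>v col T i = e"
      using Sc T i by (simp add: e_def col_mult2[of S n n T n i, symmetric])
    have Se: "S *\<^sub>v e = col S i"
      using Sc i by (simp add: e_def mult_mat_unit_vec[of _ n n])
    have "S *\<^sub>v v = e - complex_of_real t \<cdot>\<^sub>v col S i"
      using Sc e Ti by (simp add: v_def mult_minus_distrib_mat_vec[of _ n n] mult_mat_vec[of _ n n] ST Se)
    moreover have "conjugate v = conjugate (col T i) - complex_of_real t \<cdot>\<^sub>v e"
      using e Ti T i by (intro eq_vecI) (auto simp: v_def e_def)
    moreover have "e \<bullet> conjugate (col T i) = cnj (T $$ (i, i))"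
      using T i Ti by (simp add: e_def)
    moreover have "col S i \<bullet> conjugate (col T i) = 1"
    proof -
      \<comment> \<open>Moving \<open>S\<close> to the other side of the inner product leaves
        \<open>S * T\<close> applied to a unit vector.\<close>
      have "col S i \<bullet> conjugate (col T i) = e \<bullet>c (S *\<^sub>v col T i)"
        using cscalar_prod_mult_mat_vec[OF Sc(1) e Ti] by (simp add: Se Sc)
      also have "\<dots> = 1"
        using i by (simp add: ST e_def)
      finally show ?thesis .
    qed
    moreover have "e \<bullet> e = 1" "col S i \<bullet> e = S $$ (i, i)"
      using Sc i by (simp_all add: e_def)
    ultimately have "(S *\<^sub>v v) \<bullet>c v = cnj (T $$ (i, i)) - 2 * t + t\<^sup>2 * S $$ (i, i)"
      using e Ti Sc i
      by (simp add: smult_scalar_prod_distrib[of _ n] minus_scalar_prod_distrib[of _ n] scalar_prod_minus_distrib[of _ n] power2_eq_square algebra_simps)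
    moreover have "0 \<le> (S *\<^sub>v v) \<bullet>c v"
      using S v by (simp add: pos_semidef_def)
    ultimately show ?thesis
      by (simp add: less_eq_complex_def r_def s_def flip: of_real_power)
  qed
  have "0 \<le> s"
    using pos_semidef_diag_nonneg[OF S i] by (simp add: s_def less_eq_complex_def)
  \<comment> \<open>If s = 0, the quadratic at 0 gives r >= 0, while at r + 1 it gives -r - 2 >=
    0.\<close>
  moreover have "s \<noteq> 0"
    using quad[of "r + 1"] quad[of 0] by auto
  ultimately show "0 < Re (S $$ (i, i))"
    by (simp add: s_def)
  then show "1 / Re (S $$ (i, i)) \<le> Re (T $$ (i, i))"
    \<comment> \<open>The quadratic attains its minimum r - 1/s at t = 1/s.\<close>
    using quad[of "1 / s"] by (simp add: s_def r_def power2_eq_square)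
qed

(* The second bound is stated in the extended reals, where 2 / 0 = \<infinity>; in the reals it
   would be 0 at trace distance 2. *)
theorem theorem3:
  fixes n :: nat and \<rho> \<sigma> :: "complex mat"
  assumes "quantum_state n \<rho>" and "quantum_state n \<sigma>" and "invertible_mat \<sigma>"
  shows "(trace_dist \<rho> \<sigma> \<in> {0..1} \<longrightarrow> chi2_div \<rho> \<sigma> \<ge> (trace_dist \<rho> \<sigma>)\<^sup>2) \<and>
         (trace_dist \<rho> \<sigma> \<in> {1<..2} \<longrightarrow>
            ereal (chi2_div \<rho> \<sigma>) \<ge> ereal (trace_dist \<rho> \<sigma>) / ereal (2 - trace_dist \<rho> \<sigma>))"
proof -
  have psd: "pos_semidef n \<rho>" "pos_semidef n \<sigma>" and tr: "mat_trace \<rho> = 1" "mat_trace \<sigma> = 1"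
    using assms by (auto simp: quantum_state_def)
  have \<rho>: "\<rho> \<in> carrier_mat n n" "mat_adjoint \<rho> = \<rho>" and \<sigma>: "\<sigma> \<in> carrier_mat n n" "mat_adjoint \<sigma> = \<sigma>"
    using psd by (auto simp: pos_semidef_def)
  define \<tau> where "\<tau> = the (mat_inverse \<sigma>)"
  have "mat_inverse \<sigma> \<noteq> None"
  proof
    assume "mat_inverse \<sigma> = None"
    then have "\<sigma> \<notin> Units (ring_mat TYPE(complex) n ())"
      by (rule mat_inverse(1)[OF \<sigma>(1)])
    moreover obtain B where B: "\<sigma> * B = 1\<^sub>m n" "B * \<sigma> = 1\<^sub>m (dim_row B)"
      using assms(3) \<sigma> by (auto simp: invertible_mat_def inverts_mat_def)
    \<comment> \<open>\<open>invertible_mat\<close> does not fix the shape of the inverse; comparing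
      column counts in the two product equations does.\<close>
    moreover have "B \<in> carrier_mat n n"
      using arg_cong[OF B(1), of dim_col] arg_cong[OF B(2), of dim_col] \<sigma> by auto
    ultimately show False
      using \<sigma> by (auto simp: Units_def ring_mat_def)
  qed
  then have \<tau>: "\<sigma> * \<tau> = 1\<^sub>m n" "\<tau> * \<sigma> = 1\<^sub>m n" "\<tau> \<in> carrier_mat n n"
    using mat_inverse(2)[OF \<sigma>(1)] by (auto simp: \<tau>_def)
  define X where "X = \<rho> - \<sigma>"
  have X: "X \<in> carrier_mat n n" "mat_adjoint X = X"
    using \<rho> \<sigma> by (auto simp: X_def mat_adjoint_minus[of _ n n])
  obtain U d where U: "U \<in> carrier_mat n n" "mat_adjoint U * U = 1\<^sub>m n"
    and XU: "X * U = U * mat_diag n (\<lambda>i. complex_of_real (d i))"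
    using hermitian_diagonalization[OF X] .
  have UU: "U * mat_adjoint U = 1\<^sub>m n"
    using mat_mult_left_right_inverse[OF _ U] U by auto
  note assoc = assoc_mult_mat[of _ n n _ n _ n]
  let ?D = "mat_diag n (\<lambda>i. complex_of_real (d i))"
  \<comment> \<open>These are the two states and the inverse of \<open>\<sigma>\<close> in the
    eigenbasis of \<open>X\<close>. Only the difference \<open>R - S\<close> is diagonal; what
    follows compares diagonal entries.\<close>
  define R S T where "R = mat_adjoint U * \<rho> * U" and "S = mat_adjoint U * \<sigma> * U"
    and "T = mat_adjoint U * \<tau> * U"
  have c: "R \<in> carrier_mat n n" "S \<in> carrier_mat n n" "T \<in> carrier_mat n n"
    using U \<rho> \<sigma> \<tau> by (auto simp: R_def S_def T_def)
  have psd': "pos_semidef n R" "pos_semidef n S"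
    using psd U by (auto simp: R_def S_def intro: pos_semidef_conj)
  have tr': "mat_trace R = 1" "mat_trace S = 1"
    using tr \<rho> \<sigma> U UU by (simp_all add: R_def S_def mat_trace_unitary_conj[of _ n])
  have "S * T = mat_adjoint U * (\<sigma> * (U * mat_adjoint U) * \<tau>) * U"
    using U \<sigma> \<tau>(3) by (simp add: S_def T_def assoc)
  also have "\<dots> = 1\<^sub>m n"
    using U \<sigma> \<tau> by (simp add: UU)
  finally have ST: "S * T = 1\<^sub>m n" .
  have "R - S = mat_adjoint U * (X * U)"
    using U \<rho> \<sigma>
    by (simp add: R_def S_def X_def assoc minus_mult_distrib_mat[of _ n n _ _ n] mult_minus_distrib_mat[of _ n n _ n])
  also have "\<dots> = ?D"
    using U by (simp add: XU assoc[symmetric] left_mult_one_mat[of _ n n])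
  finally have RS: "R - S = ?D" .
  have d: "d i = Re (R $$ (i, i)) - Re (S $$ (i, i))" if "i < n" for i
    using arg_cong[OF RS, of "\<lambda>M. Re (M $$ (i, i))"] that c by (simp add: mat_diag_def)
  have t: "trace_dist \<rho> \<sigma> = (\<Sum>i<n. \<bar>Re (R $$ (i, i)) - Re (S $$ (i, i))\<bar>)"
  proof -
    let ?A = "mat_diag n (\<lambda>i. complex_of_real \<bar>d i\<bar>)"
    have "mat_trace (mat_abs X) = mat_trace (U * ?A * mat_adjoint U)"
      by (simp add: mat_abs_hermitian[OF X U XU])
    also have "\<dots> = mat_trace ?A"
      using mat_trace_unitary_conj[of ?A n "mat_adjoint U"] U by simp
    also have "\<dots> = complex_of_real (\<Sum>i<n. \<bar>d i\<bar>)"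
      by (simp add: mat_trace_def mat_diag_def)
    finally show ?thesis
      by (simp add: trace_dist_def X_def d del: of_real_sum)
  qed
  have chi: "chi2_div \<rho> \<sigma> = (\<Sum>i<n. (d i)\<^sup>2 * Re (T $$ (i, i)))"
  proof -
    \<comment> \<open>The divergence is first rewritten as the trace of
      \<open>X * X * \<tau>\<close>. Expanding the square, the cross term \<sigma>\<rho>\<tau> has
      trace 1 by cyclicity, which accounts for the -1 in \<open>chi2_div\<close>, and
      \<open>X\<close> has trace 0.\<close>
    have "X * X * \<tau> = X * \<rho> * \<tau> - X * \<sigma> * \<tau>"
      using \<rho> \<sigma> \<tau>(3) X by (subst (2) X_def)
        (simp add: minus_mult_distrib_mat[of _ n n _ _ n] mult_minus_distrib_mat[of _ n n _ n])
    also have "X * \<sigma> * \<tau> = X"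
      using X \<sigma> \<tau> by (simp add: assoc)
    also have "X * \<rho> * \<tau> = \<rho> * \<rho> * \<tau> - \<sigma> * \<rho> * \<tau>"
      using \<rho> \<sigma> \<tau>(3) by (simp add: X_def minus_mult_distrib_mat[of _ n n _ _ n])
    finally have "mat_trace (X * X * \<tau>) = mat_trace (\<rho> * \<rho> * \<tau>) - mat_trace (\<sigma> * \<rho> * \<tau>) - mat_trace X"
      using \<rho> \<sigma> \<tau> X by (simp add: mat_trace_minus[of _ n] minus_carrier_mat)
    also have "mat_trace (\<sigma> * \<rho> * \<tau>) = mat_trace (\<tau> * (\<sigma> * \<rho>))"
      using \<rho> \<sigma> \<tau> by (intro mat_trace_comm) auto
    also have "\<tau> * (\<sigma> * \<rho>) = \<rho>"
      using \<rho> \<sigma> \<tau> by (simp add: assoc[symmetric])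
    also have "mat_trace X = 0"
      using \<rho> \<sigma> tr by (simp add: X_def mat_trace_minus[of _ n])
    finally have "chi2_div \<rho> \<sigma> = Re (mat_trace (X * X * \<tau>))"
      using tr by (simp add: chi2_div_def \<tau>_def)
    \<comment> \<open>Inserting the identity as \<open>U * mat_adjoint U\<close> lets
      \<open>X\<close> act on its eigenbasis; cyclicity of the trace then leaves
      \<open>?D * ?D * T\<close>, where only the diagonal of \<open>T\<close> counts.\<close>
    also have "X * X * \<tau> = X * (X * (U * mat_adjoint U)) * \<tau>"
      using X by (simp add: UU)
    also have "\<dots> = X * (X * U) * (mat_adjoint U * \<tau>)"
      using X U(1) \<tau>(3) by (simp add: assoc)
    also have "X * (X * U) = X * U * ?D"
      using X U(1) by (subst XU) (simp add: assoc)
    also have "X * U * ?D * (mat_adjoint U * \<tau>) = U * (?D * ?D * (mat_adjoint U * \<tau>))"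
      unfolding XU using U(1) \<tau>(3) by (simp add: assoc del: mat_diag_diag)
    also have "mat_trace \<dots> = mat_trace (?D * ?D * (mat_adjoint U * \<tau>) * U)"
      using U \<tau> by (intro mat_trace_comm) auto
    also have "?D * ?D * (mat_adjoint U * \<tau>) * U = ?D * ?D * T"
      using U \<tau>(3) by (simp add: T_def assoc del: mat_diag_diag)
    also have "Re (mat_trace \<dots>) = (\<Sum>i<n. (d i)\<^sup>2 * Re (T $$ (i, i)))"
      by (simp add: mat_trace_def mat_diag_mult_left[OF c(3)] power2_eq_square flip: of_real_mult)
    finally show ?thesis .
  qed
  note inv = pos_semidef_inverse_diag[OF psd'(2) c(3) ST]
  have "(\<Sum>i<n. (Re (R $$ (i, i)) - Re (S $$ (i, i)))\<^sup>2 / Re (S $$ (i, i))) \<le> chi2_div \<rho> \<sigma>"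
    unfolding chi
  proof (intro sum_mono)
    fix i assume i: "i \<in> {..<n}"
    then have "(d i)\<^sup>2 * (1 / Re (S $$ (i, i))) \<le> (d i)\<^sup>2 * Re (T $$ (i, i))"
      using inv by (intro mult_left_mono) auto
    then show "(Re (R $$ (i, i)) - Re (S $$ (i, i)))\<^sup>2 / Re (S $$ (i, i)) \<le> (d i)\<^sup>2 * Re (T $$ (i, i))"
      using i by (simp add: d)
  qed
  moreover have "0 \<le> Re (R $$ (i, i))" if "i \<in> {..<n}" for i
    using pos_semidef_diag_nonneg[OF psd'(1)] that by (simp add: less_eq_complex_def)
  moreover have "(\<Sum>i<n. Re (R $$ (i, i))) = 1" "(\<Sum>i<n. Re (S $$ (i, i))) = 1"
    using arg_cong[OF tr'(1), of Re] arg_cong[OF tr'(2), of Re] c by (simp_all add: mat_trace_def)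
  ultimately have "(trace_dist \<rho> \<sigma>)\<^sup>2 \<le> chi2_div \<rho> \<sigma>"
    and "1 < trace_dist \<rho> \<sigma> \<Longrightarrow> trace_dist \<rho> \<sigma> < 2 \<and>
      trace_dist \<rho> \<sigma> / (2 - trace_dist \<rho> \<sigma>) \<le> chi2_div \<rho> \<sigma>"
    using classical_chi2_bound[OF finite_lessThan _ _ _ _ t] inv(1) by blast+
  \<comment> \<open>In the second range the denominator is positive, so the extended real quotient
    is the embedded real one.\<close>
  then show ?thesis
    by auto
qed

end
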